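(* Let $\mathbf{A}$ be a class of algorithms that work with words in an alphabet $X$ and suppose that $\mathbf{A}$ has a universal algorithm. Then for every set $\mathbf{P}$ of predicates on words there is an additively optimal problem complexity $C\{Pr(P(x),M)\}$; that is, there is an algorithm $M$ in $\mathbf{A}$ such that for every algorithm $H$ in $\mathbf{A}$ there is a number $k$ such that for every predicate $P(x)\in\mathbf{P}$, $$C\{Pr(P(x),M)\}\le C\{Pr(P(x),H)\}+k .$$
   Context: Words are finite words in the alphabet $X$, $X^*$ is the set of all of them, and $l(p)$ is the length of a word $p$. For an algorithm $H$ in $\mathbf{A}$, $H(p)$ is its result on input $p$, when it exists. For a predicate $P(x)$ on words and an algorithm $H$, $$C\{Pr(P(x),H)\}=\min\{\,l(p) : H(p)=w \text{ and } P(w)\text{ is true}\,\},$$ with the value $\infty$ when $H$ produces no word $w$ for which $P(w)$ is true ($\infty$ is larger than any number and $\infty+k=\infty$). Universal algorithm: let $\mathbf{c}:\mathbf{A}\to X^*$ be a codification of the algorithms of $\mathbf{A}$ by words (an algorithm can be reconstructed from its code) and let $\langle\cdot,\cdot\rangle$ be a pairing function, which assigns to each pair of words a word so that different pairs are mapped into different words. An algorithm $U$ is universal for the class $\mathbf{A}$ if for every algorithm $H$ from $\mathbf{A}$ and every word $x$, when the word $\langle\mathbf{c}(H),x\rangle$ is given as the input to $U$, the result of $U$ is equal to the result of $H$ applied to $x$.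
   Formalization: The pairing function is additionally assumed to satisfy: for each H in A there is k with l(⟨c(H),x⟩) ≤ l(x)+k for all words x; with an arbitrary injective pairing the claim is false. *)

theory Defs
  imports Main "HOL-Library.Extended_Nat"
begin

text \<open>
  The alphabet is the type \<open>'x\<close> and words are lists over it. Algorithms are objects of an
  arbitrary type \<open>'alg\<close> (so that different algorithms may compute the same function);
  \<open>res H p\<close> is the result \<open>H(p)\<close>, which is \<open>None\<close> when \<open>H\<close> gives no result on \<open>p\<close>.
\<close>

text \<open>
  In \<^typ>\<open>enat\<close> the infimum of a nonempty set is its minimum, and \<open>Inf {} = \<infinity>\<close>.
\<close>

definition problem_complexity ::
    "('alg \<Rightarrow> 'x list \<Rightarrow> 'x list option) \<Rightarrow> ('x list \<Rightarrow> bool) \<Rightarrow> 'alg \<Rightarrow> enat" where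
  "problem_complexity res P H = Inf {enat (length p) |p. \<exists>w. res H p = Some w \<and> P w}"

definition codification :: "'alg set \<Rightarrow> ('alg \<Rightarrow> 'x list) \<Rightarrow> bool" where
  "codification A c \<longleftrightarrow> inj_on c A"

definition pairing_function :: "('x list \<Rightarrow> 'x list \<Rightarrow> 'x list) \<Rightarrow> bool" where
  "pairing_function pair \<longleftrightarrow> inj (\<lambda>(u, v). pair u v)"

text \<open>
  The equation is between options: \<open>U\<close> has no result on the pair whenever \<open>H\<close> has none on \<open>x\<close>.
\<close>

definition universal_algorithm ::
    "('alg \<Rightarrow> 'x list \<Rightarrow> 'x list option) \<Rightarrow> 'alg set \<Rightarrow> ('alg \<Rightarrow> 'x list) \<Rightarrow>
     ('x list \<Rightarrow> 'x list \<Rightarrow> 'x list) \<Rightarrow> 'alg \<Rightarrow> bool" where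
  "universal_algorithm res A c pair U \<longleftrightarrow> (\<forall>H\<in>A. \<forall>x. res U (pair (c H) x) = res H x)"

text \<open>
  Injectivity of the pairing does not limit the length of a pair, and without such a limit
  simulation by a universal algorithm can cost more than a constant. The usual pairings that
  prefix \<open>x\<close> with a self-delimiting form of \<open>u\<close> satisfy this property for all \<open>u\<close>; only the
  codes of the algorithms in \<open>A\<close> matter.
\<close>

definition additive_length_pairing ::
    "'alg set \<Rightarrow> ('alg \<Rightarrow> 'x list) \<Rightarrow> ('x list \<Rightarrow> 'x list \<Rightarrow> 'x list) \<Rightarrow> bool" where
  "additive_length_pairing A c pair \<longleftrightarrow>
     (\<forall>H\<in>A. \<exists>k. \<forall>x. length (pair (c H) x) \<le> length x + k)"

definition additively_optimal ::
    "('alg \<Rightarrow> 'x list \<Rightarrow> 'x list option) \<Rightarrow> 'alg set \<Rightarrow> ('x list \<Rightarrow> bool) set \<Rightarrow> 'alg \<Rightarrow> bool" where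
  "additively_optimal res A PP M \<longleftrightarrow>
     (\<forall>H\<in>A. \<exists>k::nat. \<forall>P\<in>PP. problem_complexity res P M \<le> problem_complexity res P H + enat k)"

end

theory Submission
  imports Defs
begin

text \<open>The universal algorithm is itself optimal. If \<open>H\<close> yields a word satisfying
  \<open>P\<close> from a shortest input \<open>p\<close>, then \<open>U\<close> yields the same
  word from \<open>pair (c H) p\<close>, which is longer than \<open>p\<close> by at most a constant
  determined by \<open>H\<close>. Neither the translation of inputs nor this constant depends on
  \<open>P\<close>, so one constant serves all predicates.
  \<open>problem_complexity_simulation\<close> carries the argument.\<close>

lemma problem_complexity_le:
  assumes "res H p = Some w" and "P w"
  shows "problem_complexity res P H \<le> enat (length p)"
  unfolding problem_complexity_def using assms by (blast intro: Inf_lower)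

text \<open>Since \<open>Inf {}\<close> is \<infinity>, a finite value forces the set of lengths to
  be nonempty, and well-ordering of \<open>enat\<close> puts the infimum in the set.\<close>

lemma problem_complexity_attained:
  assumes "problem_complexity res P H \<noteq> \<infinity>"
  obtains p w where "res H p = Some w" and "P w"
    and "problem_complexity res P H = enat (length p)"
proof -
  let ?S = "{enat (length p) |p. \<exists>w. res H p = Some w \<and> P w}"
  have "?S \<noteq> {}"
    using assms unfolding problem_complexity_def by (metis Inf_empty top_enat_def)
  then have "Inf ?S \<in> ?S"
    by (metis (no_types, lifting) wellorder_InfI ex_in_conv)
  then show thesis
    using that unfolding problem_complexity_def by auto
qed

text \<open>The map \<open>f\<close> turns a shortest successful input of \<open>H\<close> into a
  successful, perhaps not shortest, input of \<open>M\<close>.\<close>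

lemma problem_complexity_simulation:
  assumes sim: "\<And>x. res M (f x) = res H x"
    and len: "\<And>x. length (f x) \<le> length x + k"
  shows "problem_complexity res P M \<le> problem_complexity res P H + enat k"
\<comment> \<open>In the infinite case the right-hand side is \<infinity>; the closing
  \<open>simp\<close> settles it.\<close>
proof (cases "problem_complexity res P H = \<infinity>")
  case False
  then obtain p w where p: "res H p = Some w" "P w"
    and eq: "problem_complexity res P H = enat (length p)"
    by (rule problem_complexity_attained)
  have "problem_complexity res P M \<le> enat (length (f p))"
    using p by (intro problem_complexity_le) (simp_all add: sim)
  also have "\<dots> \<le> enat (length p + k)"
    using len by simp
  finally show ?thesis
    by (simp add: eq)
qed simp

theorem theorem4p1:
  fixes res :: "'alg \<Rightarrow> 'x list \<Rightarrow> 'x list option"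
    and A :: "'alg set"
    and c :: "'alg \<Rightarrow> 'x list"
    and pair :: "'x list \<Rightarrow> 'x list \<Rightarrow> 'x list"
    and PP :: "('x list \<Rightarrow> bool) set"
  assumes "codification A c"
    and "pairing_function pair"
    and "additive_length_pairing A c pair"
    and "\<exists>U\<in>A. universal_algorithm res A c pair U"
  shows "\<exists>M\<in>A. additively_optimal res A PP M"
proof -
  obtain U where "U \<in> A" and U: "universal_algorithm res A c pair U"
    using assms(4) by blast
  have "additively_optimal res A PP U"
    unfolding additively_optimal_def
  proof
    fix H assume "H \<in> A"
    \<comment> \<open>The constant is fixed by \<open>H\<close> before any predicate is chosen, as
      the order of quantifiers demands.\<close>
    obtain k where k: "\<And>x. length (pair (c H) x) \<le> length x + k"
      using assms(3) \<open>H \<in> A\<close> unfolding additive_length_pairing_def by blast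
    have "\<And>x. res U (pair (c H) x) = res H x"
      using U \<open>H \<in> A\<close> unfolding universal_algorithm_def by blast
    \<comment> \<open>The simulation lemma applies with \<open>pair (c H)\<close> as the translation
      \<open>f\<close>.\<close>
    then show "\<exists>k. \<forall>P\<in>PP. problem_complexity res P U \<le> problem_complexity res P H + enat k"
      using k by (blast intro: problem_complexity_simulation)
  qed
  with \<open>U \<in> A\<close> show ?thesis
    by blast
qed

end
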